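(* Let $N$ be a positive integer and let $h\in\mathbb{Z}$ satisfy $|h|<\frac{N}{2}$. Suppose $N\neq \pm 2h$ and $h\neq 0$. For every positive integer $n$ we have \[ \sum_{\substack{m\in\mathbb{Z}\\ m\equiv h \pmod{N}}} m^2\, r_{h,N}^{\mathrm{e}-\mathrm{o}}\left(n-m^2+h^2\right)=\sum_{d\mid n} d\,e_d, \] where the right-hand sum runs over the positive divisors $d$ of $n$ and \[ e_n=\begin{cases} 1&\text{if } n\equiv \pm(N^2+2hN) \pmod{2N^2},\\ -1&\text{if } n\equiv 0,\ 2N^2,\ \pm(2N^2+4hN) \pmod{4N^2},\\ 0&\text{otherwise.} \end{cases} \]
   Context: For a positive integer $N$, an integer $h$ with $|h|<\frac N2$, and an integer $n$, let $r_{h,N}^{\mathrm{e}}(n)$ (resp. $r_{h,N}^{\mathrm{o}}(n)$) be the number of pairs consisting of an even (resp. odd) integer $\ell\ge 0$ and an ordered tuple $(s_1,\dots,s_\ell)\in(\mathbb{Z}\setminus\{0\})^\ell$ with \[ \sum_{j=1}^\ell \left(s_j^2N^2+2s_jhN\right)=n. \] The empty tuple ($\ell=0$) counts as a representation of $0$, so $r_{h,N}^{\mathrm{e}}(0)=1$ and $r_{h,N}^{\mathrm{o}}(0)=0$; both functions vanish at negative integers. Set $r_{h,N}^{\mathrm{e}-\mathrm{o}}(n):=r_{h,N}^{\mathrm{e}}(n)-r_{h,N}^{\mathrm{o}}(n)$.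
   Formalization: When N = 6|h|, some n satisfy both the first and the second case of e_n; there e_n is taken to be 0. With the value 1 or -1 the identity fails (N = 6, h = 1, n = 48: the left side is 24, the right side 24 + 48 e_48). *)

theory Defs
  imports "HOL-Analysis.Infinite_Sum" "HOL-Number_Theory.Cong"
begin

text \<open>
  A pair consisting of a length $\ell$ and a tuple in $(\mathbb{Z} - \{0\})^\ell$ is encoded as a
  list of nonzero integers of length $\ell$.
\<close>

definition reps :: "int \<Rightarrow> int \<Rightarrow> int \<Rightarrow> int list set" where
  "reps h N n = {ss. 0 \<notin> set ss \<and> (\<Sum>s\<leftarrow>ss. s\<^sup>2 * N\<^sup>2 + 2 * s * h * N) = n}"

definition r_even :: "int \<Rightarrow> int \<Rightarrow> int \<Rightarrow> nat" where
  "r_even h N n = card {ss \<in> reps h N n. even (length ss)}"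

definition r_odd :: "int \<Rightarrow> int \<Rightarrow> int \<Rightarrow> nat" where
  "r_odd h N n = card {ss \<in> reps h N n. odd (length ss)}"

definition r_diff :: "int \<Rightarrow> int \<Rightarrow> int \<Rightarrow> int" where
  "r_diff h N n = int (r_even h N n) - int (r_odd h N n)"

definition e_pos :: "int \<Rightarrow> int \<Rightarrow> int \<Rightarrow> bool" where
  "e_pos h N n \<longleftrightarrow>
     [n = N\<^sup>2 + 2 * h * N] (mod 2 * N\<^sup>2) \<or> [n = - (N\<^sup>2 + 2 * h * N)] (mod 2 * N\<^sup>2)"

definition e_neg :: "int \<Rightarrow> int \<Rightarrow> int \<Rightarrow> bool" where
  "e_neg h N n \<longleftrightarrow>
     [n = 0] (mod 4 * N\<^sup>2) \<or> [n = 2 * N\<^sup>2] (mod 4 * N\<^sup>2) \<or>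
     [n = 2 * N\<^sup>2 + 4 * h * N] (mod 4 * N\<^sup>2) \<or> [n = - (2 * N\<^sup>2 + 4 * h * N)] (mod 4 * N\<^sup>2)"

text \<open>
  For $h \neq 0$ and $2|h| < N$ the two congruence conditions exclude each other unless
  $N = 6|h|$. In that case some $n$ satisfy both (for instance $h = 1$, $N = 6$, $n = 48$); the
  contributions $1$ and $-1$ of the two conditions then add up to $0$.
\<close>

definition e_coeff :: "int \<Rightarrow> int \<Rightarrow> int \<Rightarrow> int" where
  "e_coeff h N n =
     (if e_pos h N n \<and> e_neg h N n then 0
      else if e_pos h N n then 1
      else if e_neg h N n then - 1
      else 0)"

text \<open>
  The remaining facts show that neither \<open>card\<close> above nor the summation over all $m$ congruent to
  $h$ modulo $N$ takes a default value.
\<close>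

lemma summand_ge_abs:
  fixes h N s :: int
  assumes "2 * \<bar>h\<bar> < N" "s \<noteq> 0"
  shows "\<bar>s\<bar> \<le> s\<^sup>2 * N\<^sup>2 + 2 * s * h * N"
proof -
  have N: "N \<ge> 1" and s: "\<bar>s\<bar> \<ge> 1" using assms by auto
  have "- (2 * s * h) \<le> \<bar>s\<bar> * (2 * \<bar>h\<bar>)"
    using abs_ge_minus_self[of "2 * s * h"] by (simp add: abs_mult mult_ac)
  also have "\<dots> \<le> \<bar>s\<bar> * (N - 1)"
    using assms by (intro mult_left_mono) auto
  finally have 1: "\<bar>s\<bar> * (N - 1) + 2 * s * h \<ge> 0" by linarith
  have "\<bar>s\<bar> * N \<le> \<bar>s\<bar> * (\<bar>s\<bar> * N)"
    using s N by (intro mult_left_mono) auto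
  also have "\<dots> = s\<^sup>2 * N" by (simp add: power2_eq_square flip: mult.assoc)
  finally have "\<bar>s\<bar> \<le> s\<^sup>2 * N + 2 * s * h"
    using 1 by (simp add: algebra_simps)
  also have "\<dots> \<le> (s\<^sup>2 * N + 2 * s * h) * N"
  proof -
    have "0 \<le> s\<^sup>2 * N + 2 * s * h" using calculation s by linarith
    from mult_left_mono[OF N this] show ?thesis by simp
  qed
  finally show ?thesis by (simp add: power2_eq_square algebra_simps)
qed

lemma list_bounds:
  fixes h N :: int
  assumes "2 * \<bar>h\<bar> < N" "0 \<notin> set ss"
  shows "int (length ss) \<le> (\<Sum>s\<leftarrow>ss. s\<^sup>2 * N\<^sup>2 + 2 * s * h * N)"
    and "s \<in> set ss \<Longrightarrow> \<bar>s\<bar> \<le> (\<Sum>s\<leftarrow>ss. s\<^sup>2 * N\<^sup>2 + 2 * s * h * N)"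
proof -
  have "int (length ss) \<le> (\<Sum>s\<leftarrow>ss. s\<^sup>2 * N\<^sup>2 + 2 * s * h * N) \<and>
      (\<forall>s\<in>set ss. \<bar>s\<bar> \<le> (\<Sum>s\<leftarrow>ss. s\<^sup>2 * N\<^sup>2 + 2 * s * h * N))"
    using assms(2)
  proof (induction ss)
    case (Cons a ss)
    then have "a \<noteq> 0" by auto
    with summand_ge_abs[OF assms(1) this] Cons show ?case by fastforce
  qed simp
  then show "int (length ss) \<le> (\<Sum>s\<leftarrow>ss. s\<^sup>2 * N\<^sup>2 + 2 * s * h * N)"
    and "s \<in> set ss \<Longrightarrow> \<bar>s\<bar> \<le> (\<Sum>s\<leftarrow>ss. s\<^sup>2 * N\<^sup>2 + 2 * s * h * N)"
    by blast+
qed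

lemma finite_reps:
  fixes h N n :: int
  assumes "2 * \<bar>h\<bar> < N"
  shows "finite (reps h N n)"
proof (rule finite_subset)
  show "reps h N n \<subseteq> {ss. set ss \<subseteq> {-n..n} \<and> length ss \<le> nat n}"
    using list_bounds[OF assms] by (fastforce simp: reps_def abs_le_iff)
  show "finite {ss :: int list. set ss \<subseteq> {-n..n} \<and> length ss \<le> nat n}"
    by (rule finite_lists_length_le) simp
qed

lemma r_diff_neg:
  fixes h N n :: int
  assumes "2 * \<bar>h\<bar> < N" "n < 0"
  shows "r_diff h N n = 0"
proof -
  have "reps h N n = {}"
    using list_bounds(1)[OF assms(1)] assms(2) by (fastforce simp: reps_def)
  then show ?thesis by (simp add: r_diff_def r_even_def r_odd_def)
qed

lemma finite_support:
  fixes h N n :: int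
  assumes "2 * \<bar>h\<bar> < N"
  shows "finite {m. m\<^sup>2 * r_diff h N (n - m\<^sup>2 + h\<^sup>2) \<noteq> 0}"
proof (rule finite_subset)
  let ?B = "\<bar>n + h\<^sup>2\<bar>"
  show "{m. m\<^sup>2 * r_diff h N (n - m\<^sup>2 + h\<^sup>2) \<noteq> 0} \<subseteq> {-?B..?B}"
  proof
    fix m assume "m \<in> {m. m\<^sup>2 * r_diff h N (n - m\<^sup>2 + h\<^sup>2) \<noteq> 0}"
    then have "\<not> n - m\<^sup>2 + h\<^sup>2 < 0" using r_diff_neg[OF assms] by fastforce
    then have "m\<^sup>2 \<le> ?B" by linarith
    moreover have "\<bar>m\<bar> \<le> m\<^sup>2"
      using mult_left_mono[of 1 "\<bar>m\<bar>" "\<bar>m\<bar>"]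
      by (cases "m = 0") (auto simp: power2_eq_square simp flip: abs_mult)
    ultimately show "m \<in> {-?B..?B}" by (auto simp: abs_le_iff)
  qed
qed simp

end

theory Submission imports Defs "HOL-Computational_Algebra.Formal_Power_Series"
begin

text \<open>
  Write \<open>m = s * N + h\<close>. Then \<open>m^2 - h^2 = N^2 * s^2 + 2 * h * N * s\<close>, so the numbers that are
  represented are sums of exponents of the theta series \<open>T = \<Sum>s. X^(N^2 * s^2 + 2 * h * N * s)\<close>.
  Counting tuples of nonzero integers with the sign of the parity of their length gives the geometric
  series \<open>R = \<Sum>l. (1 - T)^l = 1 / T\<close>. As \<open>m^2\<close> is the exponent of its term plus \<open>h^2\<close>, the
  left-hand side of the theorem is the coefficient of \<open>X^n\<close> in \<open>R * (X * T' + h^2 * T) = X * T' / T + h^2\<close>.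
  For \<open>n > 0\<close> this is a coefficient of the logarithmic derivative of \<open>T\<close>.

  The Jacobi triple product writes \<open>T\<close> as a product of factors \<open>1 - X^k\<close> with \<open>2 * N^2\<close> dividing \<open>k\<close>
  and \<open>1 + X^k\<close> with \<open>k\<close> congruent to \<open>N^2 + 2 * h * N\<close> or to its negative modulo \<open>2 * N^2\<close>.
  The logarithmic derivative of a product is a sum; a factor \<open>1 - X^k\<close> contributes \<open>-k\<close> to each
  positive multiple of \<open>k\<close>, and \<open>1 + X^k = (1 - X^(2 * k)) / (1 - X^k)\<close> contributes \<open>k\<close> to the
  multiples of \<open>k\<close> and \<open>-2 * k\<close> to those of \<open>2 * k\<close>. Collecting the contributions to \<open>X^n\<close> by the
  divisors of \<open>n\<close> gives the divisor sum.

  Infinite products are avoided: the \<open>q\<close>-binomial theorem gives an exact finite form of the triple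
  product (\<open>finite_triple_product\<close>). Since the central Gaussian binomial coefficients times a
  \<open>q\<close>-factorial tend to \<open>1\<close> (\<open>central_qbinom_limit\<close>), its \<open>n\<close>-th partial product agrees with \<open>T\<close>
  modulo \<open>X^(n+1)\<close> (\<open>triple_product_cong\<close>). That suffices, because each coefficient of the identity
  \<open>X * T' = T * L\<close> with the divisor series \<open>L\<close> (\<open>log_deriv_theta\<close>) depends on finitely many
  coefficients of \<open>T\<close>. The relation \<open>R * T = 1\<close> is \<open>r_series_inverse\<close>.
\<close>

unbundle fps_syntax

section \<open>Gaussian binomial coefficients and the finite triple product\<close>

text \<open>
  The \<open>q\<close>-Pascal recursion for the Gaussian binomial coefficients needs no division, so it makes sense
  in every commutative ring.
\<close>

fun qbinom :: "'a::comm_ring_1 \<Rightarrow> nat \<Rightarrow> nat \<Rightarrow> 'a" where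
  "qbinom q m 0 = 1"
| "qbinom q 0 (Suc j) = 0"
| "qbinom q (Suc m) (Suc j) = qbinom q m j + q ^ Suc j * qbinom q m (Suc j)"

definition qpoch :: "'a::comm_ring_1 \<Rightarrow> nat \<Rightarrow> 'a" where
  "qpoch q n = (\<Prod>k<n. 1 - q ^ Suc k)"

lemma qpoch_0 [simp]: "qpoch q 0 = 1"
  and qpoch_Suc: "qpoch q (Suc n) = qpoch q n * (1 - q ^ Suc n)"
  by (simp_all add: qpoch_def)

lemma qbinom_eq_0: "m < j \<Longrightarrow> qbinom q m j = 0"
  by (induction q m j rule: qbinom.induct) auto

text \<open>
  The product formula \<open>[m, j] = (q)_m / ((q)_j (q)_(m-j))\<close>, freed of denominators, where
  \<open>(q)_n\<close> stands for \<open>qpoch q n\<close>. The two terms of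
  the recursion contribute \<open>1 - q^(j+1)\<close> and \<open>q^(j+1) * (1 - q^(m-j))\<close> times the common factor, and
  these telescope to \<open>1 - q^(m+1)\<close>.
\<close>

lemma qbinom_mult_qpoch:
  assumes "j \<le> m"
  shows "qbinom q m j * (qpoch q j * qpoch q (m - j)) = qpoch q m"
  using assms
proof (induction q m j rule: qbinom.induct)
  case (3 q m j)
  show ?case
  proof (cases "j = m")
    case True
    with "3.IH"(1) show ?thesis
      by (simp add: qbinom_eq_0 qpoch_Suc flip: mult.assoc)
  next
    case False
    with "3.prems" have "j < m" by simp
    then obtain r where r: "m = Suc j + r" using less_imp_Suc_add by auto
    have IH1: "qbinom q m j * (qpoch q j * qpoch q (Suc r)) = qpoch q m"
      using "3.IH"(1) r by simp
    have IH2: "qbinom q m (Suc j) * (qpoch q (Suc j) * qpoch q r) = qpoch q m"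
      using "3.IH"(2) r by simp
    have "qbinom q (Suc m) (Suc j) * (qpoch q (Suc j) * qpoch q (Suc r)) =
        (1 - q ^ Suc j) * (qbinom q m j * (qpoch q j * qpoch q (Suc r))) +
        q ^ Suc j * (1 - q ^ Suc r) * (qbinom q m (Suc j) * (qpoch q (Suc j) * qpoch q r))"
      unfolding qbinom.simps(3) qpoch_Suc by (simp only: algebra_simps)
    also have "\<dots> = qpoch q m * (1 - q ^ Suc j * q ^ Suc r)"
      unfolding IH1 IH2 by (simp only: algebra_simps mult_1)
    also have "\<dots> = qpoch q (Suc m)"
      unfolding qpoch_Suc using r by (simp add: power_add mult_ac)
    finally show ?thesis using r by simp
  qed
qed auto

text \<open>
  In this homogeneous form the induction splits off the factor with \<open>k = 0\<close>: the others are the same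
  product with \<open>z * q\<close> for \<open>z\<close>, and comparing coefficients leaves the \<open>q\<close>-Pascal recursion.
\<close>

theorem q_binomial_theorem:
  fixes q y z :: "'a::comm_ring_1"
  shows "(\<Prod>k<m. y + z * q ^ k) =
    (\<Sum>j\<le>m. qbinom q m j * q ^ (j choose 2) * z ^ j * y ^ (m - j))"
proof (induction m arbitrary: z)
  case (Suc m)
  let ?t = "\<lambda>j. qbinom q m j * q ^ (Suc j choose 2) * z ^ j"
  have choose: "Suc j choose 2 = (j choose 2) + j" for j
    by (simp add: numeral_2_eq_2)
  have "(\<Prod>k<Suc m. y + z * q ^ k) = (y + z) * (\<Prod>k<m. y + (z * q) * q ^ k)"
    by (subst prod.lessThan_Suc_shift) (simp add: mult_ac)
  also have "(\<Prod>k<m. y + (z * q) * q ^ k) = (\<Sum>j\<le>m. ?t j * y ^ (m - j))"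
    unfolding Suc.IH
    by (intro sum.cong) (simp_all add: choose power_add power_mult_distrib mult_ac)
  also have "(y + z) * \<dots> = (\<Sum>j\<le>m. ?t j * y ^ (Suc m - j)) + (\<Sum>j\<le>m. z * ?t j * y ^ (m - j))"
    by (simp add: distrib_right sum_distrib_left Suc_diff_le mult_ac sum.distrib)
  also have "(\<Sum>j\<le>m. ?t j * y ^ (Suc m - j)) = (\<Sum>j\<le>Suc m. ?t j * y ^ (Suc m - j))"
    by (simp add: qbinom_eq_0)
  also have "\<dots> = y ^ Suc m + (\<Sum>j\<le>m. ?t (Suc j) * y ^ (m - j))"
    by (subst sum.atMost_Suc_shift) (simp add: numeral_2_eq_2)
  also have "\<dots> + (\<Sum>j\<le>m. z * ?t j * y ^ (m - j)) = y ^ Suc m +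
      (\<Sum>j\<le>m. qbinom q (Suc m) (Suc j) * q ^ (Suc j choose 2) * z ^ Suc j * y ^ (m - j))"
    by (simp add: choose[of "Suc _"] power_add algebra_simps flip: sum.distrib)
  also have "\<dots> = (\<Sum>j\<le>Suc m. qbinom q (Suc m) j * q ^ (j choose 2) * z ^ j * y ^ (Suc m - j))"
    by (subst sum.atMost_Suc_shift) (simp add: numeral_2_eq_2)
  finally show ?case .
qed (simp add: numeral_2_eq_2)

lemma prod_geometric: "(\<Prod>k<n. a * q ^ k) = a ^ n * q ^ (n choose 2)"
  for a q :: "'a::comm_ring_1"
  by (induction n) (simp_all add: numeral_2_eq_2 power_add mult_ac)

text \<open>
  This is the \<open>q\<close>-binomial theorem for \<open>2 * n\<close> factors with \<open>y = q^n\<close> and \<open>z = a\<close>: the upper half of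
  the factors is \<open>q^n * (1 + a * q^k)\<close>, and since \<open>q = a * b\<close> each factor of the lower half is a
  monomial times \<open>1 + b * q^k\<close>. The monomials are kept on the left because \<open>a\<close> and \<open>q\<close> are not
  assumed to be cancellable.
\<close>

lemma finite_triple_product:
  fixes a b q :: "'a::comm_ring_1"
  assumes "q = a * b"
  shows "a ^ n * q ^ (n choose 2) * q ^ (n * n) * (\<Prod>k<n. (1 + a * q ^ k) * (1 + b * q ^ k)) =
    (\<Sum>j\<le>2 * n. qbinom q (2 * n) j * (q ^ (j choose 2) * a ^ j * q ^ (n * (2 * n - j))))"
proof -
  \<comment> \<open>Reversing the order of the lower factors makes the powers of \<open>q\<close> beside \<open>b\<close> ascend.\<close>
  have "(\<Prod>k<n. q ^ n + a * q ^ k) = (\<Prod>k<n. q ^ n + a * q ^ (n - Suc k))"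
    by (rule prod.nat_diff_reindex[symmetric])
  also have "\<dots> = (\<Prod>k<n. a * q ^ (n - Suc k) * (1 + b * q ^ k))"
  proof (intro prod.cong refl)
    fix k assume "k \<in> {..<n}"
    then have "n = (n - Suc k) + Suc k" by simp
    then have "q ^ n = q ^ (n - Suc k) * (q * q ^ k)"
      by (metis power_add power_Suc)
    then show "q ^ n + a * q ^ (n - Suc k) = a * q ^ (n - Suc k) * (1 + b * q ^ k)"
      by (simp add: assms algebra_simps)
  qed
  also have "\<dots> = a ^ n * q ^ (n choose 2) * (\<Prod>k<n. 1 + b * q ^ k)"
    unfolding prod.distrib[of "\<lambda>k. a * q ^ (n - Suc k)"]
    by (simp only: prod.nat_diff_reindex[of "\<lambda>k. a * q ^ k"] prod_geometric)
  finally have lower: "(\<Prod>k<n. q ^ n + a * q ^ k) = \<dots>" .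
  have "(\<Prod>k<n. q ^ n + a * q ^ (k + n)) = (\<Prod>k<n. q ^ n * (1 + a * q ^ k))"
    by (intro prod.cong) (simp_all add: power_add algebra_simps)
  also have "\<dots> = q ^ (n * n) * (\<Prod>k<n. 1 + a * q ^ k)"
    by (simp add: prod.distrib power_mult)
  finally have upper: "(\<Prod>k<n. q ^ n + a * q ^ (k + n)) = \<dots>" .
  have split: "(\<Prod>k<n + m. f k) = (\<Prod>k<n. f k) * (\<Prod>k<m. f (k + n))"
    for f :: "nat \<Rightarrow> 'a" and m n
    by (induction m) (simp_all add: mult.assoc add.commute)
  have "(\<Prod>k<2 * n. q ^ n + a * q ^ k) =
      (\<Prod>k<n. q ^ n + a * q ^ k) * (\<Prod>k<n. q ^ n + a * q ^ (k + n))"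
    using split[of "\<lambda>k. q ^ n + a * q ^ k" n n] by (simp add: mult_2)
  then have "a ^ n * q ^ (n choose 2) * q ^ (n * n) * (\<Prod>k<n. (1 + a * q ^ k) * (1 + b * q ^ k)) =
      (\<Prod>k<2 * n. q ^ n + a * q ^ k)"
    unfolding lower upper by (simp add: prod.distrib mult_ac)
  also have "\<dots> = (\<Sum>j\<le>2 * n. qbinom q (2 * n) j * (q ^ (j choose 2) * a ^ j * q ^ (n * (2 * n - j))))"
    by (simp only: q_binomial_theorem power_mult mult.assoc)
  finally show ?thesis .
qed

section \<open>Congruences modulo powers of \<open>X\<close>\<close>

lemma fps_X_power_dvd_iff:
  "fps_X ^ m dvd f \<longleftrightarrow> (\<forall>i<m. f $ i = 0)" for f :: "'a::comm_ring_1 fps"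
proof
  assume "\<forall>i<m. f $ i = 0"
  then have "f = fps_X ^ m * fps_shift m f"
    by (auto simp: fps_eq_iff fps_X_power_mult_nth)
  then show "fps_X ^ m dvd f" by (rule dvdI)
qed (auto simp: dvd_def fps_X_power_mult_nth)

lemma fps_X_power_dvd_unit_cancel:
  fixes f p :: "'a::comm_ring_1 fps"
  assumes "fps_X ^ m dvd p * f" "p $ 0 = 1"
  shows "fps_X ^ m dvd f"
proof -
  have "fps_right_inverse p 1 * p = 1"
    using fps_right_inverse[of p 1] assms(2) by (simp add: mult.commute)
  then have "f = fps_right_inverse p 1 * (p * f)" by (simp flip: mult.assoc)
  with assms(1) show ?thesis by (metis dvd_mult)
qed

lemma qpoch_fps_nth_0: "0 < M \<Longrightarrow> qpoch (fps_X ^ M) n $ 0 = (1 :: 'a::comm_ring_1)"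
  by (induction n) (simp_all add: qpoch_Suc flip: power_mult power_add)

text \<open>
  The factors of index greater than \<open>n\<close> are congruent to \<open>1\<close> modulo \<open>q^(n+1)\<close>.
\<close>

lemma qpoch_cong: "q ^ Suc n dvd qpoch q (n + r) - qpoch q n" for q :: "'a::comm_ring_1"
proof (induction r)
  case (Suc r)
  have "q ^ Suc n dvd qpoch q (n + r) * q ^ Suc (n + r)"
    by (intro dvd_mult le_imp_power_dvd) simp
  from dvd_diff[OF Suc this] show ?case
    by (simp add: qpoch_Suc algebra_simps)
qed simp

text \<open>
  By the product formula \<open>[2n, n+r] * (q)_(n-r) = (q)_(2n) / (q)_(n+r)\<close>, which is \<open>1\<close> up to
  \<open>q^(n+r+1)\<close>; replacing \<open>(q)_(n-r)\<close> by \<open>(q)_n\<close> changes it by a multiple of \<open>q^(n-r+1)\<close>. The precision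
  lost for large \<open>r\<close> is regained in the triple product, where the coefficient is multiplied by a
  power of \<open>X\<close> divisible by \<open>X^r\<close>.
\<close>

lemma central_qbinom_limit:
  fixes q :: "'a::comm_ring_1 fps"
  assumes q: "q = fps_X ^ M" "0 < M" and "r \<le> n" "j = n + r \<or> j = n - r"
  shows "q ^ Suc (n - r) dvd qbinom q (2 * n) j * qpoch q n - 1"
proof -
  let ?b = "qbinom q (2 * n) j" and ?P = "qpoch q"
  have "?b * (?P j * ?P (2 * n - j)) = ?P (2 * n)"
    using assms by (intro qbinom_mult_qpoch) auto
  moreover have "2 * n - (n + r) = n - r" "2 * n - (n - r) = n + r"
    using assms(3) by auto
  ultimately have fact: "?b * (?P (n + r) * ?P (n - r)) = ?P (2 * n)"
    using assms(4) by (auto simp: mult_ac)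
  have "q ^ Suc (n + r) dvd ?P (2 * n) - ?P (n + r)"
    using qpoch_cong[of q "n + r" "n - r"] assms(3) by (simp add: mult_2)
  then have "q ^ Suc (n - r) dvd ?P (2 * n) - ?P (n + r)"
    by (rule dvd_trans[rotated]) (intro le_imp_power_dvd, simp)
  moreover have "?P (2 * n) - ?P (n + r) = ?P (n + r) * (?b * ?P (n - r) - 1)"
    by (simp only: fact[symmetric]) (simp add: algebra_simps)
  ultimately have "fps_X ^ (M * Suc (n - r)) dvd ?P (n + r) * (?b * ?P (n - r) - 1)"
    unfolding q power_mult by simp
  then have "fps_X ^ (M * Suc (n - r)) dvd ?b * ?P (n - r) - 1"
    by (rule fps_X_power_dvd_unit_cancel) (simp add: q qpoch_fps_nth_0)
  then have "q ^ Suc (n - r) dvd ?b * ?P (n - r) - 1"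
    unfolding q power_mult .
  moreover have "q ^ Suc (n - r) dvd ?b * (?P n - ?P (n - r))"
    using qpoch_cong[of q "n - r" r] assms(3) by simp
  ultimately have "q ^ Suc (n - r) dvd (?b * ?P (n - r) - 1) + ?b * (?P n - ?P (n - r))"
    by (rule dvd_add)
  moreover have "(?b * ?P (n - r) - 1) + ?b * (?P n - ?P (n - r)) = ?b * ?P n - 1"
    by (simp add: right_diff_distrib)
  ultimately show ?thesis by simp
qed

section \<open>Logarithmic derivatives\<close>

text \<open>
  An equation \<open>fps_XD f = f * a\<close> says that \<open>a\<close> is the logarithmic derivative \<open>X * f' / f\<close> of \<open>f\<close>
  without dividing by \<open>f\<close>.
\<close>

lemma log_deriv_mult:
  fixes f g :: "'a::comm_ring_1 fps"
  assumes D: "fps_XD f = f * a" "fps_XD g = g * b"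
  shows "fps_XD (f * g) = f * g * (a + b)"
proof -
  have "fps_XD (f * g) = f * fps_XD g + g * fps_XD f"
    by (simp add: fps_XD_def algebra_simps)
  then show ?thesis unfolding D by (simp add: algebra_simps)
qed

lemma log_deriv_prod:
  fixes f :: "'b \<Rightarrow> 'a::comm_ring_1 fps"
  assumes "finite I" "\<And>k. k \<in> I \<Longrightarrow> fps_XD (f k) = f k * g k"
  shows "fps_XD (\<Prod>k\<in>I. f k) = (\<Prod>k\<in>I. f k) * (\<Sum>k\<in>I. g k)"
  using assms
proof (induction I)
  case empty
  show ?case by (simp add: fps_XD_def)
next
  case (insert x F)
  then show ?case by (simp add: log_deriv_mult del: fps_XD_nth)
qed

text \<open>
  The expansion of \<open>m * X^m / (1 - X^m)\<close>.
\<close>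

definition lambert :: "nat \<Rightarrow> int fps" where
  "lambert m = Abs_fps (\<lambda>i. if 0 < i \<and> m dvd i then int m else 0)"

lemma lambert_eq:
  assumes "0 < m"
  shows "(1 - fps_X ^ m) * lambert m = of_nat m * fps_X ^ m"
proof (rule fps_ext)
  fix i
  have "m \<le> i \<Longrightarrow> m dvd i - m \<longleftrightarrow> m dvd i" by (simp add: dvd_minus_self)
  moreover have "i < m \<Longrightarrow> \<not> (0 < i \<and> m dvd i)" using dvd_imp_le by fastforce
  ultimately show "((1 - fps_X ^ m) * lambert m) $ i = (of_nat m * fps_X ^ m) $ i"
    using assms by (auto simp: left_diff_distrib fps_X_power_mult_nth lambert_def fps_of_nat[symmetric])
qed

lemma fps_XD_power_X: "fps_XD (fps_X ^ m) = (of_nat m * fps_X ^ m :: int fps)"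
  by (rule fps_ext) (simp add: fps_of_nat[symmetric])

lemma log_deriv_minus:
  assumes "0 < m"
  shows "fps_XD (1 - fps_X ^ m) = (1 - fps_X ^ m) * - lambert m"
proof -
  have "fps_XD (1 - fps_X ^ m) = - fps_XD (fps_X ^ m :: int fps)" by (simp add: fps_XD_def)
  then show ?thesis using lambert_eq[OF assms] by (simp add: fps_XD_power_X)
qed

text \<open>
  Formally \<open>1 + X^m = (1 - X^(2 * m)) / (1 - X^m)\<close>; the proof multiplies by \<open>1 - X^m\<close> and cancels.
\<close>

lemma log_deriv_plus:
  assumes "0 < m"
  shows "fps_XD (1 + fps_X ^ m) = (1 + fps_X ^ m) * (lambert m - lambert (2 * m))"
proof -
  let ?x = "fps_X ^ m :: int fps"
  have double: "fps_X ^ (2 * m) = ?x * ?x"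
    by (simp add: mult_2 power_add)
  have sq: "(1 - ?x) * (1 + ?x) = 1 - fps_X ^ (2 * m)"
    unfolding double by (simp add: algebra_simps)
  have "(1 - ?x) * ((1 + ?x) * (lambert m - lambert (2 * m))) =
      (1 + ?x) * ((1 - ?x) * lambert m) - (1 - ?x) * (1 + ?x) * lambert (2 * m)"
    by (simp add: algebra_simps)
  also have "\<dots> = (1 + ?x) * (of_nat m * ?x) - of_nat (2 * m) * fps_X ^ (2 * m)"
    unfolding sq using assms by (simp add: lambert_eq del: of_nat_mult)
  also have "\<dots> = (1 - ?x) * (of_nat m * ?x)"
    unfolding double by (simp add: algebra_simps)
  finally have "(1 + ?x) * (lambert m - lambert (2 * m)) = of_nat m * ?x"
  proof -
    assume eq: "(1 - ?x) * ((1 + ?x) * (lambert m - lambert (2 * m))) = (1 - ?x) * (of_nat m * ?x)"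
    have "(1 - ?x) $ 0 \<noteq> 0" using assms by simp
    then have "1 - ?x \<noteq> 0" by (metis fps_zero_nth)
    with eq show ?thesis by simp
  qed
  moreover have "fps_XD (1 + ?x) = fps_XD ?x" by (simp add: fps_XD_def)
  ultimately show ?thesis by (simp add: fps_XD_power_X)
qed

text \<open>
  For \<open>c \<le> M\<close> the numbers \<open>c + M * k\<close> enumerate the positive integers congruent to \<open>c\<close> modulo \<open>M\<close>,
  and a divisor of \<open>i \<le> n\<close> among them has \<open>k < n\<close>.
\<close>

lemma lambert_sum_nth:
  assumes "0 < c" "c \<le> M" "0 < i" "i \<le> n"
  shows "(\<Sum>k<n. lambert (c + M * k)) $ i = (\<Sum>d | d dvd i. int d * of_bool [d = c] (mod M))"
proof -
  have inj: "inj_on (\<lambda>k. c + M * k) {..<n}"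
    using assms by (auto simp: inj_on_def)
  have "(\<Sum>k<n. lambert (c + M * k)) $ i =
      (\<Sum>k<n. int (c + M * k) * of_bool (c + M * k dvd i))"
    using assms(3) by (simp add: fps_sum_nth lambert_def of_bool_def if_distrib cong: if_cong)
  also have "\<dots> = (\<Sum>d\<in>(\<lambda>k. c + M * k) ` {..<n}. int d * of_bool (d dvd i))"
    by (simp add: sum.reindex[OF inj])
  also have "\<dots> = (\<Sum>d | d dvd i. int d * of_bool [d = c] (mod M))"
  proof (rule sum.mono_neutral_cong)
    show "finite {d. d dvd i}" using assms(3) by (simp add: finite_divisors_nat)
  next
    fix d assume d: "d \<in> {d. d dvd i} - (\<lambda>k. c + M * k) ` {..<n}"
    have "\<not> [d = c] (mod M)"
    proof
      assume cong: "[d = c] (mod M)"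
      have "0 < d" "d \<le> i" using d assms(3) by (auto intro: dvd_imp_le dvd_pos_nat)
      have "c \<le> d"
      proof (rule ccontr)
        assume "\<not> c \<le> d"
        then have "d < M" using assms(2) by simp
        with cong \<open>\<not> c \<le> d\<close> \<open>0 < d\<close> assms(2) show False
          by (cases "c = M") (auto simp: cong_def)
      qed
      then obtain k where k: "d = c + M * k"
        using cong by (metis cong_le_nat mult.commute add.commute)
      have "k \<le> M * k" using assms(1,2) by simp
      then have "k < n" using k \<open>d \<le> i\<close> assms(1,4) by linarith
      with k d show False by auto
    qed
    then show "int d * of_bool [d = c] (mod M) = 0" by simp
  qed (auto simp: cong_def)
  finally show ?thesis .
qed

section \<open>The triple product for theta series\<close>

text \<open>
  The assumption keeps the exponents \<open>A * s^2 + B * s\<close> at or above \<open>\<bar>s\<bar>\<close>, so that each power of \<open>X\<close>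
  occurs finitely often.
\<close>

locale theta_series =
  fixes A B :: int
  assumes B_less_A: "\<bar>B\<bar> < A"
begin

definition theta_exp :: "int \<Rightarrow> int" where
  "theta_exp s = A * s\<^sup>2 + B * s"

lemma abs_le_theta_exp: "\<bar>s\<bar> \<le> theta_exp s"
proof (cases "s = 0")
  case False
  have "- (B * s) \<le> \<bar>B\<bar> * \<bar>s\<bar>"
    by (metis abs_ge_minus_self abs_mult)
  also have "\<dots> \<le> (A - 1) * \<bar>s\<bar>"
    using B_less_A by (intro mult_right_mono) auto
  finally have 1: "- (B * s) \<le> (A - 1) * \<bar>s\<bar>" .
  have "\<bar>s\<bar> * 1 \<le> \<bar>s\<bar> * \<bar>s\<bar>" using False by (intro mult_left_mono) auto
  then have "A * \<bar>s\<bar> \<le> A * s\<^sup>2"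
    using B_less_A by (intro mult_left_mono) (auto simp: power2_eq_square)
  with 1 show ?thesis by (simp add: theta_exp_def algebra_simps)
qed (simp add: theta_exp_def)

lemma theta_exp_nonneg [simp]: "0 \<le> theta_exp s"
  using abs_le_theta_exp[of s] by linarith

lemma theta_exp_0 [simp]: "theta_exp 0 = 0"
  by (simp add: theta_exp_def)

lemma finite_theta_exp: "finite {s. theta_exp s \<le> k}"
proof (rule finite_subset)
  show "{s. theta_exp s \<le> k} \<subseteq> {-k..k}"
  proof
    fix s assume "s \<in> {s. theta_exp s \<le> k}"
    then show "s \<in> {-k..k}" using abs_le_theta_exp[of s] by auto
  qed
qed simp

text \<open>
  The series \<open>\<Sum>s. c s * X^(theta_exp s)\<close>. The weight \<open>c\<close> allows the theta series and its
  derivative to be treated alike.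
\<close>

definition theta :: "(int \<Rightarrow> int) \<Rightarrow> int fps" where
  "theta c = Abs_fps (\<lambda>k. \<Sum>s | theta_exp s = int k. c s)"

lemma mult_theta_nth:
  "(f * theta c) $ n = (\<Sum>s | theta_exp s \<le> int n. c s * f $ (n - nat (theta_exp s)))"
proof -
  let ?S = "{s. theta_exp s \<le> int n}" and ?g = "\<lambda>s. n - nat (theta_exp s)"
  have fib: "{s \<in> ?S. ?g s = i} = {s. theta_exp s = int (n - i)}" if "i \<in> {0..n}" for i
  proof (intro set_eqI iffI)
    fix s assume "s \<in> {s \<in> ?S. ?g s = i}"
    then show "s \<in> {s. theta_exp s = int (n - i)}" using theta_exp_nonneg[of s] by auto
  qed (use that in auto)
  have "(f * theta c) $ n = (\<Sum>i=0..n. \<Sum>s\<in>{s \<in> ?S. ?g s = i}. c s * f $ ?g s)"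
    unfolding fps_mult_nth
  proof (intro sum.cong refl)
    fix i assume i: "i \<in> {0..n}"
    have "f $ i * theta c $ (n - i) = (\<Sum>s\<in>{s \<in> ?S. ?g s = i}. c s * f $ i)"
      unfolding fib[OF i] by (simp add: theta_def sum_distrib_left mult.commute)
    also have "\<dots> = (\<Sum>s\<in>{s \<in> ?S. ?g s = i}. c s * f $ ?g s)"
      by (intro sum.cong) auto
    finally show "f $ i * theta c $ (n - i) = \<dots>" .
  qed
  also have "\<dots> = (\<Sum>s\<in>?S. c s * f $ ?g s)"
    by (intro sum.group finite_theta_exp) auto
  finally show ?thesis .
qed

lemma fps_XD_theta: "fps_XD (theta c) = theta (\<lambda>s. theta_exp s * c s)"
  by (rule fps_ext) (auto simp: theta_def sum_distrib_left intro!: sum.cong)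

text \<open>
  With \<open>u\<close> and \<open>v\<close> the theta exponent is \<open>u * s * (s + 1) / 2 + v * s * (s - 1) / 2\<close>, so the theta
  series is Ramanujan's theta function \<open>f(X^u, X^v)\<close>, whose product expansion has base \<open>X^(u+v)\<close>.
\<close>

definition u :: nat where "u = nat (A + B)"
definition v :: nat where "v = nat (A - B)"
definition M :: nat where "M = u + v"

lemma pos: "0 < u" "0 < v" "0 < M" "u \<le> M" "v \<le> M"
  using B_less_A by (auto simp: u_def v_def M_def)

lemma int_uv: "int u = A + B" "int v = A - B" "int M = 2 * A"
  using B_less_A by (auto simp: u_def v_def M_def)

definition partial_product :: "nat \<Rightarrow> int fps" where
  "partial_product n = qpoch (fps_X ^ M) n *
    (\<Prod>k<n. (1 + fps_X ^ u * (fps_X ^ M) ^ k) * (1 + fps_X ^ v * (fps_X ^ M) ^ k))"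

text \<open>
  The exponents of \<open>X\<close> in the finite triple product for \<open>a = X^u\<close>, \<open>q = X^M\<close>: beside the monomial
  of the left-hand side, the term of index \<open>j\<close> carries the theta exponent of \<open>s = j - n\<close>.
\<close>

lemma theta_exponent:
  assumes "j \<le> 2 * n"
  shows "M * (j choose 2) + u * j + M * (n * (2 * n - j)) =
    u * n + M * (n choose 2) + M * (n * n) + nat (theta_exp (int j - int n))"
proof -
  have choose: "2 * int (k choose 2) = int k * (int k - 1)" for k
    by (induction k) (simp_all add: numeral_2_eq_2 algebra_simps)
  have "2 * int (M * (j choose 2) + u * j + M * (n * (2 * n - j))) =
      int M * (2 * int (j choose 2)) + 2 * int u * int j + 2 * int M * int n * (2 * int n - int j)"
    using assms by (simp only: of_nat_add of_nat_mult of_nat_diff) (simp add: algebra_simps)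
  also have "\<dots> = 2 * int u * int n + int M * (2 * int (n choose 2)) + 2 * int M * int n * int n +
      2 * theta_exp (int j - int n)"
    unfolding choose int_uv theta_exp_def by (simp add: algebra_simps power2_eq_square)
  also have "\<dots> = 2 * int (u * n + M * (n choose 2) + M * (n * n) + nat (theta_exp (int j - int n)))"
    by (simp add: algebra_simps)
  finally show ?thesis by (metis mult_cancel_left of_nat_eq_iff zero_neq_numeral)
qed

lemma partial_product_eq:
  "partial_product n = (\<Sum>j\<le>2 * n. qbinom (fps_X ^ M) (2 * n) j * qpoch (fps_X ^ M) n *
    fps_X ^ nat (theta_exp (int j - int n)))"
proof -
  let ?q = "fps_X ^ M :: int fps" and ?a = "fps_X ^ u :: int fps" and ?b = "fps_X ^ v :: int fps"
  let ?P = "\<Prod>k<n. (1 + ?a * ?q ^ k) * (1 + ?b * ?q ^ k)"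
  let ?c = "fps_X ^ (u * n + M * (n choose 2) + M * (n * n)) :: int fps"
  have "?c * ?P = ?a ^ n * ?q ^ (n choose 2) * ?q ^ (n * n) * ?P"
    by (simp add: power_add power_mult)
  also have "\<dots> = (\<Sum>j\<le>2 * n. qbinom ?q (2 * n) j *
      (?q ^ (j choose 2) * ?a ^ j * ?q ^ (n * (2 * n - j))))"
    by (rule finite_triple_product) (simp add: M_def power_add)
  also have "\<dots> = (\<Sum>j\<le>2 * n. ?c * (qbinom ?q (2 * n) j * fps_X ^ nat (theta_exp (int j - int n))))"
  proof (intro sum.cong refl)
    fix j assume "j \<in> {..2 * n}"
    then have j: "j \<le> 2 * n" by simp
    have "?q ^ (j choose 2) * ?a ^ j * ?q ^ (n * (2 * n - j)) =
        ?c * fps_X ^ nat (theta_exp (int j - int n))"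
      unfolding power_mult[symmetric] power_add[symmetric] theta_exponent[OF j] ..
    then show "qbinom ?q (2 * n) j * (?q ^ (j choose 2) * ?a ^ j * ?q ^ (n * (2 * n - j))) =
        ?c * (qbinom ?q (2 * n) j * fps_X ^ nat (theta_exp (int j - int n)))"
      by (simp only: mult.left_commute)
  qed
  also have "\<dots> = ?c * (\<Sum>j\<le>2 * n. qbinom ?q (2 * n) j * fps_X ^ nat (theta_exp (int j - int n)))"
    by (simp only: sum_distrib_left)
  finally have "?P = (\<Sum>j\<le>2 * n. qbinom ?q (2 * n) j * fps_X ^ nat (theta_exp (int j - int n)))"
    by simp
  then show ?thesis
    unfolding partial_product_def by (simp only: sum_distrib_left mult_ac)
qed

text \<open>
  Since \<open>\<bar>s\<bar> \<le> theta_exp s\<close>, the terms with \<open>\<bar>s\<bar> > n\<close> vanish modulo \<open>X^(n+1)\<close>.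
\<close>

lemma theta_cong: "fps_X ^ Suc n dvd
  (\<Sum>j\<le>2 * n. fps_X ^ nat (theta_exp (int j - int n))) - theta (\<lambda>_. 1)"
  unfolding fps_X_power_dvd_iff
proof (intro allI impI)
  fix i assume "i < Suc n"
  have "(\<Sum>j\<le>2 * n. fps_X ^ nat (theta_exp (int j - int n))) =
      (\<Sum>s\<in>{-int n..int n}. fps_X ^ nat (theta_exp s) :: int fps)"
    by (rule sum.reindex_bij_witness[of _ "\<lambda>s. nat (s + int n)" "\<lambda>j. int j - int n"]) auto
  then have "(\<Sum>j\<le>2 * n. fps_X ^ nat (theta_exp (int j - int n)) :: int fps) $ i =
      (\<Sum>s\<in>{-int n..int n}. of_bool (i = nat (theta_exp s)))"
    by (simp add: fps_sum_nth of_bool_def)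
  also have "\<dots> = (\<Sum>s | theta_exp s = int i. 1)"
  proof (rule sum.mono_neutral_cong)
    show "finite {s. theta_exp s = int i}"
      by (rule finite_subset[OF _ finite_theta_exp[of "int i"]]) auto
    show "1 = (0 :: int)" if "s \<in> {s. theta_exp s = int i} - {-int n..int n}" for s
      using that \<open>i < Suc n\<close> abs_le_theta_exp[of s] by auto
  qed auto
  finally show "((\<Sum>j\<le>2 * n. fps_X ^ nat (theta_exp (int j - int n))) - theta (\<lambda>_. 1)) $ i = 0"
    by (simp add: theta_def)
qed

text \<open>
  The Jacobi triple product modulo \<open>X^(n+1)\<close>. The term of index \<open>j = n + s\<close> differs from
  \<open>X^(theta_exp s)\<close> by a multiple of \<open>X^(n-\<bar>s\<bar>+1) * X^(\<bar>s\<bar>)\<close>.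
\<close>

theorem triple_product_cong: "fps_X ^ Suc n dvd partial_product n - theta (\<lambda>_. 1)"
proof -
  let ?q = "fps_X ^ M :: int fps"
  let ?x = "\<lambda>j. fps_X ^ nat (theta_exp (int j - int n)) :: int fps"
  have "fps_X ^ Suc n dvd (qbinom ?q (2 * n) j * qpoch ?q n - 1) * ?x j" if j: "j \<in> {..2 * n}" for j
  proof -
    define r where "r = nat \<bar>int j - int n\<bar>"
    have r: "r \<le> n" "j = n + r \<or> j = n - r" using j by (auto simp: r_def)
    have "fps_X ^ Suc (n - r) dvd ?q ^ Suc (n - r)"
      unfolding power_mult[symmetric] using mult_le_mono1[of 1 M "Suc (n - r)"] pos(3)
      by (intro le_imp_power_dvd) simp
    also have "\<dots> dvd qbinom ?q (2 * n) j * qpoch ?q n - 1"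
      using central_qbinom_limit[OF refl pos(3) r] .
    finally have "fps_X ^ Suc (n - r) dvd qbinom ?q (2 * n) j * qpoch ?q n - 1" .
    moreover have "fps_X ^ r dvd ?x j"
      using abs_le_theta_exp[of "int j - int n"] by (intro le_imp_power_dvd) (simp add: r_def)
    ultimately have "fps_X ^ Suc (n - r) * fps_X ^ r dvd (qbinom ?q (2 * n) j * qpoch ?q n - 1) * ?x j"
      by (rule mult_dvd_mono)
    then show ?thesis using r(1) unfolding power_add[symmetric] by simp
  qed
  then have "fps_X ^ Suc n dvd (\<Sum>j\<le>2 * n. (qbinom ?q (2 * n) j * qpoch ?q n - 1) * ?x j)"
    by (rule dvd_sum)
  moreover have "(\<Sum>j\<le>2 * n. (qbinom ?q (2 * n) j * qpoch ?q n - 1) * ?x j) =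
      partial_product n - (\<Sum>j\<le>2 * n. ?x j)"
    by (simp add: partial_product_eq left_diff_distrib sum_subtractf)
  ultimately have "fps_X ^ Suc n dvd partial_product n - (\<Sum>j\<le>2 * n. ?x j)" by simp
  from dvd_add[OF this theta_cong[of n]] show ?thesis by simp
qed

text \<open>
  The net multiplicity of the index \<open>d\<close> among the series \<open>lambert d\<close> in the logarithmic derivative of
  the product. It is a sum of indicators, as different factors may produce the same \<open>d\<close>.
  The multiples of \<open>M\<close> appear as the progression that starts at \<open>M\<close>, in line with \<open>lambert_sum_nth\<close>.
\<close>

definition divisor_weight :: "nat \<Rightarrow> int" where
  "divisor_weight d = of_bool [d = u] (mod M) + of_bool [d = v] (mod M) - of_bool [d = M] (mod M)
    - of_bool [d = 2 * u] (mod 2 * M) - of_bool [d = 2 * v] (mod 2 * M)"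

definition lambert_series :: "int fps" where
  "lambert_series = Abs_fps (\<lambda>i. if i = 0 then 0 else \<Sum>d | d dvd i. int d * divisor_weight d)"

lemma log_deriv_partial_product:
  "\<exists>L. fps_XD (partial_product n) = partial_product n * L \<and> fps_X ^ Suc n dvd L - lambert_series"
proof (intro exI conjI)
  let ?X = "fps_X :: int fps"
  let ?S = "\<lambda>m. \<Sum>k<n. lambert (m k)"
  let ?L = "- ?S (\<lambda>k. M + M * k) + ((?S (\<lambda>k. u + M * k) - ?S (\<lambda>k. 2 * u + 2 * M * k)) +
    (?S (\<lambda>k. v + M * k) - ?S (\<lambda>k. 2 * v + 2 * M * k)))"
  have minus: "fps_XD (1 - (?X ^ M) ^ Suc k) = (1 - (?X ^ M) ^ Suc k) * - lambert (M + M * k)" for k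
    using log_deriv_minus[of "M + M * k"] pos by (simp add: power_mult power_add)
  have plus: "fps_XD (1 + ?X ^ c * (?X ^ M) ^ k) =
      (1 + ?X ^ c * (?X ^ M) ^ k) * (lambert (c + M * k) - lambert (2 * c + 2 * M * k))" if "0 < c" for c k
    using log_deriv_plus[of "c + M * k"] that by (simp add: power_mult power_add distrib_left mult.assoc)
  have "fps_XD (partial_product n) = partial_product n * ((\<Sum>k<n. - lambert (M + M * k)) +
     (\<Sum>k<n. (lambert (u + M * k) - lambert (2 * u + 2 * M * k)) +
       (lambert (v + M * k) - lambert (2 * v + 2 * M * k))))"
    unfolding partial_product_def qpoch_def
    by (intro log_deriv_mult log_deriv_prod finite_lessThan minus plus pos)
  also have "(\<Sum>k<n. - lambert (M + M * k)) +
     (\<Sum>k<n. (lambert (u + M * k) - lambert (2 * u + 2 * M * k)) +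
       (lambert (v + M * k) - lambert (2 * v + 2 * M * k))) = ?L"
    by (simp only: sum_negf sum.distrib sum_subtractf)
  finally show "fps_XD (partial_product n) = partial_product n * ?L" .
  show "fps_X ^ Suc n dvd ?L - lambert_series"
    unfolding fps_X_power_dvd_iff
  proof (intro allI impI)
    fix i assume i: "i < Suc n"
    show "(?L - lambert_series) $ i = 0"
    proof (cases "i = 0")
      case True
      then show ?thesis by (simp add: fps_sum_nth lambert_def lambert_series_def)
    next
      case False
      then have nth: "?S (\<lambda>k. c + m * k) $ i = (\<Sum>d | d dvd i. int d * of_bool [d = c] (mod m))"
        if "0 < c" "c \<le> m" for c m
        using lambert_sum_nth[OF that] i by simp
      have "?L $ i = (\<Sum>d | d dvd i. int d * divisor_weight d)"
        using pos by (simp only: fps_add_nth fps_sub_nth fps_neg_nth nth divisor_weight_def)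
          (simp add: nth divisor_weight_def algebra_simps sum.distrib sum_subtractf)
      then show ?thesis using False by (simp add: lambert_series_def)
    qed
  qed
qed

text \<open>
  The coefficient of \<open>X^n\<close> is read off modulo \<open>X^(n+1)\<close>, where the theta series may be replaced by its
  \<open>n\<close>-th partial product.
\<close>

theorem log_deriv_theta: "theta theta_exp = theta (\<lambda>_. 1) * lambert_series"
proof (rule fps_ext)
  fix n
  let ?T = "theta (\<lambda>_. 1)"
  obtain L where L: "fps_XD (partial_product n) = partial_product n * L"
    "fps_X ^ Suc n dvd L - lambert_series"
    using log_deriv_partial_product by blast
  have "fps_X ^ Suc n dvd fps_XD (partial_product n) - fps_XD ?T"
    using triple_product_cong[of n] unfolding fps_X_power_dvd_iff by simp
  moreover have "fps_X ^ Suc n dvd (partial_product n - ?T) * L + ?T * (L - lambert_series)"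
    using triple_product_cong[of n] L(2) by (intro dvd_add dvd_mult dvd_mult2)
  moreover have "(partial_product n - ?T) * L + ?T * (L - lambert_series)
      - (fps_XD (partial_product n) - fps_XD ?T) = fps_XD ?T - ?T * lambert_series"
    unfolding L(1) by (simp add: algebra_simps)
  ultimately have "fps_X ^ Suc n dvd fps_XD ?T - ?T * lambert_series"
    by (metis dvd_diff)
  then have "(fps_XD ?T - ?T * lambert_series) $ n = 0"
    unfolding fps_X_power_dvd_iff by blast
  then show "theta theta_exp $ n = (?T * lambert_series) $ n"
    by (simp add: fps_XD_theta del: fps_XD_nth)
qed

end

section \<open>The signed representation numbers invert the theta series\<close>

lemma r_diff_eq_sum:
  assumes "2 * \<bar>h\<bar> < N"
  shows "r_diff h N n = (\<Sum>ss\<in>reps h N n. (- 1) ^ length ss)"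
proof -
  have fin: "finite (reps h N n)" by (rule finite_reps[OF assms])
  have split: "reps h N n = {ss \<in> reps h N n. even (length ss)} \<union> {ss \<in> reps h N n. odd (length ss)}"
    by blast
  have "(\<Sum>ss\<in>reps h N n. (- 1 :: int) ^ length ss) =
      (\<Sum>ss | ss \<in> reps h N n \<and> even (length ss). (- 1) ^ length ss) +
      (\<Sum>ss | ss \<in> reps h N n \<and> odd (length ss). (- 1) ^ length ss)"
    using fin by (subst split, intro sum.union_disjoint) auto
  also have "\<dots> = r_diff h N n"
    by (simp add: r_diff_def r_even_def r_odd_def)
  finally show ?thesis by simp
qed

locale signed_representations =
  fixes h N :: int
  assumes h_small: "2 * \<bar>h\<bar> < N"
begin

sublocale theta_series "N\<^sup>2" "2 * h * N"
proof
  have "\<bar>2 * h * N\<bar> = (2 * \<bar>h\<bar>) * N" using h_small by (simp add: abs_mult)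
  also have "\<dots> < N * N" using h_small by (intro mult_strict_right_mono) auto
  finally show "\<bar>2 * h * N\<bar> < N\<^sup>2" by (simp add: power2_eq_square)
qed

lemma theta_exp_eq: "theta_exp s = s\<^sup>2 * N\<^sup>2 + 2 * s * h * N"
  unfolding theta_exp_def by (simp add: algebra_simps)

lemma reps_altdef: "reps h N n = {ss. 0 \<notin> set ss \<and> (\<Sum>s\<leftarrow>ss. theta_exp s) = n}"
  unfolding reps_def theta_exp_eq ..

text \<open>
  Removing the first entry of a nonempty tuple flips the sign and leaves a tuple that represents
  \<open>n - theta_exp s\<close>. So the terms with \<open>s \<noteq> 0\<close> add up to minus the contribution of the nonempty
  tuples to the term \<open>r_diff h N n\<close> of \<open>s = 0\<close>, and only the empty tuple is left.
\<close>

lemma sum_r_diff: "(\<Sum>s | theta_exp s \<le> n. r_diff h N (n - theta_exp s)) = of_bool (n = 0)"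
proof -
  note fin = finite_reps[OF h_small] finite_theta_exp
  let ?S = "{s. theta_exp s \<le> n} - {0}"
  let ?sgn = "\<lambda>ss :: int list. (- 1 :: int) ^ length ss"
  have Nil: "[] \<in> reps h N n \<longleftrightarrow> n = 0" by (auto simp: reps_altdef)
  have "(\<Sum>s\<in>?S. r_diff h N (n - theta_exp s)) =
      (\<Sum>(s, ss)\<in>(SIGMA s:?S. reps h N (n - theta_exp s)). ?sgn ss)"
    using fin by (simp add: r_diff_eq_sum[OF h_small] sum.Sigma)
  also have "\<dots> = (\<Sum>ss\<in>reps h N n - {[]}. - ?sgn ss)"
  proof (rule sum.reindex_bij_witness[of _ "\<lambda>ss. (hd ss, tl ss)" "\<lambda>(s, ss). s # ss"])
    fix ss assume ss: "ss \<in> reps h N n - {[]}"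
    then obtain s ts where [simp]: "ss = s # ts" by (cases ss) auto
    have "0 \<le> (\<Sum>s\<leftarrow>ts. theta_exp s)" by (rule sum_list_nonneg) auto
    with ss show "(hd ss, tl ss) \<in> (SIGMA s:?S. reps h N (n - theta_exp s))"
      by (auto simp: reps_altdef)
  qed (auto simp: reps_altdef)
  also have "\<dots> = of_bool (n = 0) - r_diff h N n"
    using fin by (simp add: r_diff_eq_sum[OF h_small] sum_negf sum_diff1 Nil)
  finally have "(\<Sum>s\<in>?S. r_diff h N (n - theta_exp s)) + r_diff h N n = of_bool (n = 0)"
    by simp
  moreover have "(\<Sum>s | theta_exp s \<le> n. r_diff h N (n - theta_exp s)) =
      (\<Sum>s\<in>?S. r_diff h N (n - theta_exp s)) + r_diff h N n" if "0 \<le> n"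
    using that finite_theta_exp[of n] by (subst sum.remove[of _ 0]) (auto simp: add.commute)
  moreover have "{s. theta_exp s \<le> n} = {}" if "\<not> 0 \<le> n"
    using that theta_exp_nonneg by (metis (mono_tags, lifting) empty_Collect_eq order_trans)
  ultimately show ?thesis by (cases "0 \<le> n") auto
qed

definition r_series :: "int fps" where
  "r_series = Abs_fps (\<lambda>k. r_diff h N (int k))"

lemma r_series_mult_theta_nth:
  "(r_series * theta c) $ n = (\<Sum>s | theta_exp s \<le> int n. c s * r_diff h N (int n - theta_exp s))"
  unfolding mult_theta_nth
proof (intro sum.cong refl)
  fix s assume "s \<in> {s. theta_exp s \<le> int n}"
  then have "int (n - nat (theta_exp s)) = int n - theta_exp s"
    using theta_exp_nonneg[of s] by auto
  then show "c s * r_series $ (n - nat (theta_exp s)) = c s * r_diff h N (int n - theta_exp s)"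
    by (simp add: r_series_def)
qed

lemma r_series_inverse: "r_series * theta (\<lambda>_. 1) = 1"
proof (rule fps_ext)
  fix n
  show "(r_series * theta (\<lambda>_. 1)) $ n = 1 $ n"
    unfolding r_series_mult_theta_nth using sum_r_diff[of "int n"] by simp
qed

theorem r_series_log_deriv: "r_series * theta theta_exp = lambert_series"
  by (simp add: log_deriv_theta r_series_inverse flip: mult.assoc)

section \<open>The divisor weights and the main identity\<close>

text \<open>
  Here \<open>A = N^2\<close> and \<open>B = 2 * h * N\<close>, so \<open>v\<close> is congruent to \<open>-u\<close> modulo \<open>M = 2 * N^2\<close>. The indicators
  in the weight can be merged into the two conditions because the residue classes of each sign are
  disjoint: two of them coincide only if \<open>M\<close> divides \<open>4 * h * N\<close>, and \<open>0 < 4 * \<bar>h\<bar> * N < 2 * N^2\<close>. Classes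
  of opposite sign may meet; there the weight is \<open>0\<close>, in agreement with \<open>e_coeff\<close>.
\<close>

lemma divisor_weight_eq_e_coeff:
  assumes "h \<noteq> 0"
  shows "divisor_weight d = e_coeff h N (int d)"
proof -
  have N: "0 < N" using h_small by linarith
  define K where "K = int M"
  have K: "K = 2 * N\<^sup>2" using int_uv(3) by (simp add: K_def)
  have cong_of_nat: "[a = b] (mod k) \<longleftrightarrow> [int a = int b] (mod int k)" for a b k
    by (simp add: cong_int_iff)
  \<comment> \<open>Over the integers, the classes of \<open>u\<close>, \<open>v\<close> and their doubles are those of \<open>\<plusminus>U\<close> and \<open>\<plusminus>2 * U\<close>.\<close>
  define U V where "U = N\<^sup>2 + 2 * h * N" and "V = N\<^sup>2 - 2 * h * N"
  have not_cong: "\<not> [x = y] (mod K)" if "\<bar>x - y\<bar> = 4 * \<bar>h\<bar> * N" for x y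
  proof
    assume "[x = y] (mod K)"
    then have "K dvd \<bar>x - y\<bar>" by (simp add: cong_iff_dvd_diff)
    moreover have "0 < 4 * \<bar>h\<bar> * N" using assms N by simp
    ultimately have "2 * N * N \<le> 4 * \<bar>h\<bar> * N"
      unfolding that K using zdvd_imp_le by (fastforce simp: power2_eq_square)
    then have "2 * N \<le> 4 * \<bar>h\<bar>" using N by simp
    with h_small show False by simp
  qed
  have UV: "\<not> [U = V] (mod K)"
    using N by (intro not_cong) (simp add: U_def V_def abs_mult)
  have 2: "\<not> [2 * U = K] (mod K)" "\<not> [2 * V = K] (mod K)"
    using N by (intro not_cong, simp add: U_def V_def K abs_mult)+
  have UV2: "\<not> [2 * U = 2 * V] (mod 2 * K)"
    using UV by (simp add: cong_def mod_mult_mult1)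
  have pos_iff: "e_pos h N (int d) \<longleftrightarrow> [int d = U] (mod K) \<or> [int d = V] (mod K)"
  proof -
    have "[- U = V] (mod K)" by (simp add: cong_iff_dvd_diff U_def V_def K)
    then have "[int d = - U] (mod K) \<longleftrightarrow> [int d = V] (mod K)"
      by (auto simp: cong_def)
    then show ?thesis by (simp add: e_pos_def U_def K)
  qed
  have neg_iff: "e_neg h N (int d) \<longleftrightarrow> [int d = K] (mod K) \<or>
      [int d = 2 * U] (mod 2 * K) \<or> [int d = 2 * V] (mod 2 * K)"
  proof -
    have "[- (2 * U) = 2 * V] (mod 2 * K)" by (simp add: cong_iff_dvd_diff U_def V_def K)
    then have "[int d = - (2 * U)] (mod 2 * K) \<longleftrightarrow> [int d = 2 * V] (mod 2 * K)"
      by (auto simp: cong_def)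
    moreover have "[int d = K] (mod K) \<longleftrightarrow>
        [int d = 0] (mod 2 * K) \<or> [int d = K] (mod 2 * K)"
    proof
      assume "[int d = K] (mod K)"
      then obtain k where k: "int d = K * k" by (auto simp: cong_def elim: dvdE)
      show "[int d = 0] (mod 2 * K) \<or> [int d = K] (mod 2 * K)"
        unfolding k by (cases "even k") (auto simp: cong_iff_dvd_diff algebra_simps elim!: evenE oddE)
    next
      assume "[int d = 0] (mod 2 * K) \<or> [int d = K] (mod 2 * K)"
      then have "[int d = 0] (mod K) \<or> [int d = K] (mod K)"
        by (meson cong_dvd_modulus dvd_triv_right)
      then show "[int d = K] (mod K)" by (auto simp: cong_def)
    qed
    ultimately show ?thesis by (simp add: e_neg_def U_def K algebra_simps)
  qed
  have "\<not> ([int d = U] (mod K) \<and> [int d = V] (mod K))"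
    using UV by (meson cong_sym cong_trans)
  moreover have "\<not> ([int d = 2 * U] (mod 2 * K) \<and> [int d = 2 * V] (mod 2 * K))"
    using UV2 by (meson cong_sym cong_trans)
  moreover have "\<not> ([int d = K] (mod K) \<and> [int d = 2 * W] (mod 2 * K))"
    if "\<not> [2 * W = K] (mod K)" for W
    using that by (meson cong_dvd_modulus dvd_triv_right cong_sym cong_trans)
  ultimately show ?thesis
    using 2 unfolding divisor_weight_def cong_of_nat of_nat_mult of_nat_numeral int_uv(1,2)
      U_def[symmetric] V_def[symmetric] K_def[symmetric]
    by (auto simp: e_coeff_def pos_iff neg_iff)
qed

end

theorem theorem1p4:
  fixes N h n :: int
  assumes "N > 0"
    and "real_of_int \<bar>h\<bar> < real_of_int N / 2"
    and "N \<noteq> 2 * h" and "N \<noteq> - 2 * h"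
    and "h \<noteq> 0"
    and "n > 0"
  shows "((\<lambda>m. m\<^sup>2 * r_diff h N (n - m\<^sup>2 + h\<^sup>2)) has_sum
           (\<Sum>d | d > 0 \<and> d dvd n. d * e_coeff h N d)) {m. [m = h] (mod N)}"
proof -
  interpret signed_representations h N
    using assms(2) by unfold_locales linarith
  have square: "(s * N + h)\<^sup>2 = theta_exp s + h\<^sup>2" for s
    unfolding theta_exp_eq by (simp add: power2_eq_square algebra_simps)
  let ?f = "\<lambda>m. m\<^sup>2 * r_diff h N (n - m\<^sup>2 + h\<^sup>2)"
  let ?S = "{s. theta_exp s \<le> n}" and ?g = "\<lambda>s. s * N + h"
  have inj: "inj_on ?g A" for A using assms(1) by (auto simp: inj_on_def)
  have "sum ?f (?g ` ?S) = (\<Sum>s\<in>?S. (theta_exp s + h\<^sup>2) * r_diff h N (n - theta_exp s))"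
    by (simp add: sum.reindex[OF inj] square)
  also have "\<dots> = (\<Sum>s\<in>?S. theta_exp s * r_diff h N (n - theta_exp s)) +
      h\<^sup>2 * (\<Sum>s\<in>?S. r_diff h N (n - theta_exp s))"
    by (simp add: distrib_right sum.distrib sum_distrib_left)
  also have "\<dots> = (r_series * theta theta_exp) $ nat n"
    using assms(6) by (simp add: sum_r_diff r_series_mult_theta_nth)
  also have "\<dots> = (\<Sum>d | d dvd nat n. int d * e_coeff h N (int d))"
    using assms(5,6) by (simp add: r_series_log_deriv lambert_series_def divisor_weight_eq_e_coeff)
  also have "\<dots> = (\<Sum>d | d > 0 \<and> d dvd n. d * e_coeff h N d)"
    using assms(6) by (intro sum.reindex_bij_witness[of _ nat int])
      (auto simp: nat_dvd_iff int_dvd_int_iff[symmetric] intro!: Nat.gr0I)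
  finally have "(?f has_sum (\<Sum>d | d > 0 \<and> d dvd n. d * e_coeff h N d)) (?g ` ?S)"
    by (intro has_sum_finiteI finite_imageI finite_theta_exp) simp
  moreover have "?f m = 0" if "[m = h] (mod N)" "m \<notin> ?g ` ?S" for m
  proof -
    from that(1) obtain s where s: "m = ?g s"
      by (metis cong_iff_lin cong_sym mult.commute add.commute)
    with that(2) have "n < theta_exp s" by auto
    then show ?thesis using r_diff_neg[OF h_small] by (simp add: s square)
  qed
  moreover have "[?g s = h] (mod N)" for s
    by (simp add: cong_def)
  ultimately show ?thesis
    by (subst has_sum_cong_neutral[where T = "?g ` ?S" and g = ?f]) auto
qed

end
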